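(* Let $\Phi$ be a field of characteristic $3$ and let $n\ge1$. The $J$-ternary algebra $\mathcal{O}=\mathcal{O}(1;\underline n)$ over $\Phi$, with trilinear product $(f,g,h)\mapsto fg\,\partial(h)-hg\,\partial(f)$, is simple.
   Context: $\mathcal{O}=\mathcal{O}(1;\underline n)$ is the divided power algebra over $\Phi$ with basis $x^{(i)}$, $0\le i<3^n$, and product $x^{(i)}x^{(j)}=\binom{i+j}{i}x^{(i+j)}$ (with $x^{(k)}=0$ for $k\ge3^n$). The derivation $\partial$ of $\mathcal{O}$ is given by $\partial(x^{(i)})=x^{(i-1)}$ for $i\ge1$ and $\partial(x^{(0)})=0$. A $J$-ternary algebra is a vector space $X$ with a trilinear map $(x,y,z)\mapsto xyz$ such that for all $x,y,z,u,v,w\in X$: (1) $xy(uvw)-uv(xyw)=(xyu)vw+u(yxv)w$; (2) $xyz-zyx=zxy-xzy$. The space $\mathcal{O}$ with the trilinear product above is a $J$-ternary algebra. An ideal of $X$ is a subspace $I$ such that $xyz\in I$ whenever at least one of $x,y,z$ lies in $I$; $X$ is simple if its triple product is nonzero and its only ideals are $0$ and $X$. *)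

theory Defs
  imports
    Complex_Main
    "HOL-Library.Function_Algebras"
begin

text \<open>The space \<open>X\<close> is a subspace of an ambient vector space; the triple product is only constrained on
  \<open>X\<close>.\<close>

locale J_ternary_algebra = vector_space scale
  for scale :: "'a::field \<Rightarrow> 'b::ab_group_add \<Rightarrow> 'b" (infixr \<open>*s\<close> 75) +
  fixes X :: "'b set" and T :: "'b \<Rightarrow> 'b \<Rightarrow> 'b \<Rightarrow> 'b"
  assumes subspace_X: "subspace X"
    and T_closed: "\<lbrakk>x \<in> X; y \<in> X; z \<in> X\<rbrakk> \<Longrightarrow> T x y z \<in> X"
    and T_add_1: "\<lbrakk>x \<in> X; x' \<in> X; y \<in> X; z \<in> X\<rbrakk> \<Longrightarrow> T (x + x') y z = T x y z + T x' y z"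
    and T_add_2: "\<lbrakk>x \<in> X; y \<in> X; y' \<in> X; z \<in> X\<rbrakk> \<Longrightarrow> T x (y + y') z = T x y z + T x y' z"
    and T_add_3: "\<lbrakk>x \<in> X; y \<in> X; z \<in> X; z' \<in> X\<rbrakk> \<Longrightarrow> T x y (z + z') = T x y z + T x y z'"
    and T_scale_1: "\<lbrakk>x \<in> X; y \<in> X; z \<in> X\<rbrakk> \<Longrightarrow> T (c *s x) y z = c *s T x y z"
    and T_scale_2: "\<lbrakk>x \<in> X; y \<in> X; z \<in> X\<rbrakk> \<Longrightarrow> T x (c *s y) z = c *s T x y z"
    and T_scale_3: "\<lbrakk>x \<in> X; y \<in> X; z \<in> X\<rbrakk> \<Longrightarrow> T x y (c *s z) = c *s T x y z"
    and J_ternary_1: "\<lbrakk>x \<in> X; y \<in> X; u \<in> X; v \<in> X; w \<in> X\<rbrakk> \<Longrightarrow>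
      T x y (T u v w) - T u v (T x y w) = T (T x y u) v w + T u (T y x v) w"
    and J_ternary_2: "\<lbrakk>x \<in> X; y \<in> X; z \<in> X\<rbrakk> \<Longrightarrow>
      T x y z - T z y x = T z x y - T x z y"
begin

definition ideal :: "'b set \<Rightarrow> bool" where
  "ideal I \<longleftrightarrow> I \<subseteq> X \<and> subspace I \<and>
    (\<forall>x\<in>X. \<forall>y\<in>X. \<forall>z\<in>X. x \<in> I \<or> y \<in> I \<or> z \<in> I \<longrightarrow> T x y z \<in> I)"

end

locale simple_J_ternary_algebra = J_ternary_algebra +
  assumes T_nonzero: "\<exists>x\<in>X. \<exists>y\<in>X. \<exists>z\<in>X. T x y z \<noteq> 0"
    and ideal_trivial: "ideal I \<Longrightarrow> I = {0} \<or> I = X"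

text \<open>Elements of the divided power algebra are encoded by their coordinates: \<open>f\<close> stands for
  \<open>\<Sum>i<3^n. f i x\<^sup>(\<^sup>i\<^sup>)\<close>.  Beware that \<open>(*)\<close> on functions is the pointwise product; the product of the
  algebra is \<open>dp_mult\<close>.\<close>

definition fun_scale :: "'a::field \<Rightarrow> (nat \<Rightarrow> 'a) \<Rightarrow> nat \<Rightarrow> 'a" where
  "fun_scale c f = (\<lambda>i. c * f i)"

definition dp_space :: "nat \<Rightarrow> (nat \<Rightarrow> 'a::field) set" where
  "dp_space n = {f. \<forall>i\<ge>3 ^ n. f i = 0}"

definition dp_basis :: "nat \<Rightarrow> nat \<Rightarrow> nat \<Rightarrow> 'a::field" where
  "dp_basis n k = (\<lambda>i. if i = k \<and> k < 3 ^ n then 1 else 0)"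

definition dp_mult :: "nat \<Rightarrow> (nat \<Rightarrow> 'a::field) \<Rightarrow> (nat \<Rightarrow> 'a) \<Rightarrow> nat \<Rightarrow> 'a" where
  "dp_mult n f g = (\<Sum>i<3 ^ n. \<Sum>j<3 ^ n.
     fun_scale (f i * g j * of_nat ((i + j) choose i)) (dp_basis n (i + j)))"

definition dp_deriv :: "nat \<Rightarrow> (nat \<Rightarrow> 'a::field) \<Rightarrow> nat \<Rightarrow> 'a" where
  "dp_deriv n f = (\<Sum>i\<in>{1..<3 ^ n}. fun_scale (f i) (dp_basis n (i - 1)))"

definition dp_triple ::
  "nat \<Rightarrow> (nat \<Rightarrow> 'a::field) \<Rightarrow> (nat \<Rightarrow> 'a) \<Rightarrow> (nat \<Rightarrow> 'a) \<Rightarrow> nat \<Rightarrow> 'a" where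
  "dp_triple n f g h =
     dp_mult n (dp_mult n f g) (dp_deriv n h) - dp_mult n (dp_mult n h g) (dp_deriv n f)"

lemma sum_fun_apply: "(\<Sum>i\<in>A. F i) k = (\<Sum>i\<in>A. F i k)"
  for F :: "'i \<Rightarrow> 'k \<Rightarrow> 'a::comm_monoid_add"
  by (induction A rule: infinite_finite_induct) auto

lemma dp_basis_mult:
  assumes "i < 3 ^ n" "j < 3 ^ n"
  shows "dp_mult n (dp_basis n i) (dp_basis n j) =
    fun_scale (of_nat ((i + j) choose i)) (dp_basis n (i + j) :: nat \<Rightarrow> 'a::field)"
proof
  fix k
  let ?F = "\<lambda>a b. dp_basis n i a * dp_basis n j b * of_nat ((a + b) choose a) * dp_basis n (a + b) k :: 'a"
  have b: "(\<Sum>b<3^n. ?F a b) = (if a = i then ?F i j else 0)" for a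
  proof -
    have "(\<Sum>b<3^n. ?F a b) = (\<Sum>b<3^n. if b = j then ?F a j else 0)"
      by (rule sum.cong) (auto simp: dp_basis_def)
    then show ?thesis using assms by (auto simp: dp_basis_def)
  qed
  have "(\<Sum>a<3^n. \<Sum>b<3^n. ?F a b) = ?F i j"
    unfolding b using assms by simp
  then show "dp_mult n (dp_basis n i) (dp_basis n j) k =
    fun_scale (of_nat ((i + j) choose i)) (dp_basis n (i + j) :: nat \<Rightarrow> 'a) k"
    using assms by (simp add: dp_mult_def fun_scale_def sum_fun_apply) (simp add: dp_basis_def)
qed

lemma dp_deriv_apply: "dp_deriv n f k = (if Suc k < 3 ^ n then f (Suc k) else 0)"
proof -
  have "dp_deriv n f k = (\<Sum>i\<in>{1..<3 ^ n}. if i = Suc k then f i else 0)"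
    unfolding dp_deriv_def sum_fun_apply fun_scale_def
    by (rule sum.cong) (auto simp: dp_basis_def)
  then show ?thesis by simp
qed

lemma dp_basis_deriv:
  "i < 3 ^ n \<Longrightarrow> dp_deriv n (dp_basis n i :: nat \<Rightarrow> 'a::field) =
    (if i = 0 then 0 else dp_basis n (i - 1))"
  by (rule ext) (auto simp: dp_deriv_apply dp_basis_def)

end

theory Submission
  imports Defs
begin

text \<open>
  The divided power algebra is a differential subalgebra of the Hurwitz series, that is, of all
  sequences with the product \<open>(f \<star> g) k = (\<Sum>i\<le>k. (k choose i) f i g (k - i))\<close>, whose canonical
  derivation is the shift \<open>\<partial>\<close>.  Indeed \<open>dp_space n\<close> is the kernel of \<open>\<partial> ^^ 3 ^ n\<close>, and in
  characteristic 3 the cube of a derivation is again a derivation, so that \<open>\<partial> ^^ 3 ^ n\<close> is one and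
  its kernel is closed under \<open>\<star>\<close> (\<open>hurwitz_mult_in_dp_space\<close>).  This replaces all computations
  with binomial coefficients modulo 3, and the truncation in \<open>dp_mult\<close> becomes invisible
  (\<open>dp_mult_eq_hurwitz_mult\<close>).

  The triple product is therefore \<open>(f, g, h) \<mapsto> g \<star> W f h\<close>, where \<open>W f h = f \<star> \<partial> h - h \<star> \<partial> f\<close> is the
  Wronskian.  The first axiom of a \<open>J\<close>-ternary algebra is then an identity in every commutative
  differential ring; in the second one, the two sides differ by \<open>3 (g \<star> W f h)\<close>.

  For simplicity, the element 1 satisfies \<open>W 1 f = \<partial> f\<close>.  Hence a nonzero ideal is closed under
  \<open>\<partial>\<close>, and differentiating a nonzero element until only its leading coefficient is left shows
  that the ideal contains 1.  Since \<open>W 1 x = 1\<close>, the triple product of \<open>1\<close>, \<open>g\<close> and \<open>x\<close> is \<open>g\<close>,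
  and the ideal is everything.
\<close>

section \<open>The ring of Hurwitz series\<close>

definition hurwitz_mult :: "(nat \<Rightarrow> 'a::field) \<Rightarrow> (nat \<Rightarrow> 'a) \<Rightarrow> nat \<Rightarrow> 'a" (infixl \<open>\<star>\<close> 70) where
  "f \<star> g = (\<lambda>k. \<Sum>i\<le>k. of_nat (k choose i) * f i * g (k - i))"

definition shift :: "(nat \<Rightarrow> 'a) \<Rightarrow> nat \<Rightarrow> 'a" (\<open>\<partial>\<close>) where
  "\<partial> f = (\<lambda>k. f (Suc k))"

lemma hurwitz_mult_0 [simp]: "(f \<star> g) 0 = f 0 * g 0"
  by (simp add: hurwitz_mult_def)

lemma shift_add: "\<partial> (f + g) = \<partial> f + \<partial> g"
  by (simp add: shift_def fun_eq_iff)

lemma shift_diff: "\<partial> (f - g) = \<partial> f - \<partial> g"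
  by (simp add: shift_def fun_eq_iff)

lemma shift_fun_scale: "\<partial> (fun_scale c f) = fun_scale c (\<partial> f)"
  by (simp add: shift_def fun_scale_def)

text \<open>This is Pascal's rule.\<close>

lemma shift_hurwitz_mult: "\<partial> (f \<star> g) = \<partial> f \<star> g + f \<star> \<partial> g"
proof
  fix k
  have "\<partial> (f \<star> g) k = (\<Sum>i\<le>Suc k. of_nat (Suc k choose i) * f i * g (Suc k - i))"
    by (simp add: shift_def hurwitz_mult_def)
  also have "\<dots> = f 0 * g (Suc k) + (\<Sum>i\<le>k. of_nat (Suc k choose Suc i) * f (Suc i) * g (k - i))"
    by (simp add: sum.atMost_Suc_shift del: sum.atMost_Suc)
  also have "\<dots> = (\<Sum>i\<le>k. of_nat (k choose i) * f (Suc i) * g (k - i)) +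
      (f 0 * g (Suc k) + (\<Sum>i\<le>k. of_nat (k choose Suc i) * f (Suc i) * g (k - i)))"
    by (simp add: algebra_simps sum.distrib)
  also have "f 0 * g (Suc k) + (\<Sum>i\<le>k. of_nat (k choose Suc i) * f (Suc i) * g (k - i)) =
      (\<Sum>i\<le>Suc k. of_nat (k choose i) * f i * g (Suc k - i))"
    by (simp add: sum.atMost_Suc_shift del: sum.atMost_Suc)
  also have "\<dots> = (\<Sum>i\<le>k. of_nat (k choose i) * f i * g (Suc (k - i)))"
    by (simp add: Suc_diff_le binomial_eq_0)
  finally show "\<partial> (f \<star> g) k = (\<partial> f \<star> g + f \<star> \<partial> g) k"
    by (simp add: hurwitz_mult_def shift_def)
qed

lemma hurwitz_mult_Suc: "(f \<star> g) (Suc k) = (\<partial> f \<star> g) k + (f \<star> \<partial> g) k"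
  using fun_cong[OF shift_hurwitz_mult, of f g k] by (simp add: shift_def)

lemma hurwitz_mult_add_left: "(f + g) \<star> h = f \<star> h + g \<star> h"
  by (simp add: hurwitz_mult_def fun_eq_iff algebra_simps sum.distrib)

lemma hurwitz_mult_diff_left: "(f - g) \<star> h = f \<star> h - g \<star> h"
  by (simp add: hurwitz_mult_def fun_eq_iff algebra_simps sum_subtractf)

lemma hurwitz_mult_fun_scale_left: "fun_scale c f \<star> g = fun_scale c (f \<star> g)"
  by (simp add: hurwitz_mult_def fun_scale_def fun_eq_iff sum_distrib_left mult_ac)

text \<open>
  A series is determined by the constant terms of its iterated derivatives, so the ring laws
  follow from the Leibniz rule by induction on the index.
\<close>

lemma hurwitz_mult_commute: "f \<star> g = g \<star> f"
proof
  show "(f \<star> g) k = (g \<star> f) k" for k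
    by (induction k arbitrary: f g) (simp_all add: hurwitz_mult_Suc)
qed

lemma hurwitz_mult_assoc: "f \<star> g \<star> h = f \<star> (g \<star> h)"
proof
  fix k
  show "(f \<star> g \<star> h) k = (f \<star> (g \<star> h)) k"
  proof (induction k arbitrary: f g h)
    case (Suc k)
    have "(f \<star> g \<star> h) (Suc k) = (\<partial> f \<star> g \<star> h) k + (f \<star> \<partial> g \<star> h) k + (f \<star> g \<star> \<partial> h) k"
      by (simp add: hurwitz_mult_Suc shift_hurwitz_mult hurwitz_mult_add_left)
    also have "\<dots> = (\<partial> f \<star> (g \<star> h)) k + (f \<star> (\<partial> g \<star> h)) k + (f \<star> (g \<star> \<partial> h)) k"
      by (simp add: Suc)
    also have "\<dots> = (\<partial> f \<star> (g \<star> h)) k + (f \<star> (\<partial> g \<star> h + g \<star> \<partial> h)) k"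
      by (simp add: hurwitz_mult_commute[of f] hurwitz_mult_add_left)
    finally show ?case
      by (simp add: hurwitz_mult_Suc shift_hurwitz_mult)
  qed simp
qed

lemma hurwitz_mult_left_commute: "f \<star> (g \<star> h) = g \<star> (f \<star> h)"
  by (metis hurwitz_mult_assoc hurwitz_mult_commute)

lemma hurwitz_mult_add_right: "f \<star> (g + h) = f \<star> g + f \<star> h"
  by (simp add: hurwitz_mult_commute[of f] hurwitz_mult_add_left)

lemma hurwitz_mult_diff_right: "f \<star> (g - h) = f \<star> g - f \<star> h"
  by (simp add: hurwitz_mult_commute[of f] hurwitz_mult_diff_left)

lemma hurwitz_mult_fun_scale_right: "f \<star> fun_scale c g = fun_scale c (f \<star> g)"
  by (simp add: hurwitz_mult_commute[of f] hurwitz_mult_fun_scale_left)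

lemmas hurwitz_mult_simps =
  hurwitz_mult_add_left hurwitz_mult_add_right hurwitz_mult_diff_left hurwitz_mult_diff_right
  hurwitz_mult_assoc hurwitz_mult_commute hurwitz_mult_left_commute

lemma fun_scale_diff: "fun_scale c (f - g) = fun_scale c f - fun_scale c g"
  by (simp add: fun_scale_def fun_eq_iff algebra_simps)

lemma vector_space_fun_scale: "vector_space (fun_scale :: 'a::field \<Rightarrow> (nat \<Rightarrow> 'a) \<Rightarrow> nat \<Rightarrow> 'a)"
  by unfold_locales (auto simp: fun_scale_def fun_eq_iff algebra_simps)


section \<open>The divided power algebra as a differential subalgebra\<close>

definition derivation :: "((nat \<Rightarrow> 'a::field) \<Rightarrow> nat \<Rightarrow> 'a) \<Rightarrow> bool" where
  "derivation E \<longleftrightarrow> (\<forall>f g. E (f + g) = E f + E g) \<and> (\<forall>f g. E (f \<star> g) = E f \<star> g + f \<star> E g)"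

lemma char_3_triple_eq_0:
  fixes f :: "nat \<Rightarrow> 'a::field"
  assumes "CHAR('a) = 3"
  shows "f + (f + f) = 0"
proof
  fix k
  have "(of_nat 3 :: 'a) = 0"
    using of_nat_CHAR[where ?'a = 'a] assms by simp
  then have "of_nat 3 * f k = 0"
    by (simp only: mult_zero_left)
  then show "(f + (f + f)) k = 0 k"
    by (simp add: algebra_simps)
qed

text \<open>
  In \<open>E\<^sup>3 (f \<star> g) = E\<^sup>3 f \<star> g + 3 (E\<^sup>2 f \<star> E g) + 3 (E f \<star> E\<^sup>2 g) + f \<star> E\<^sup>3 g\<close> the two mixed terms
  vanish.
\<close>

lemma derivation_funpow_3:
  fixes E :: "(nat \<Rightarrow> 'a::field) \<Rightarrow> nat \<Rightarrow> 'a"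
  assumes "CHAR('a) = 3" and "derivation E"
  shows "derivation (E ^^ 3)"
proof -
  have add: "E (f + g) = E f + E g" and mult: "E (f \<star> g) = E f \<star> g + f \<star> E g" for f g
    using assms(2) by (auto simp: derivation_def)
  have "E (E (E (f \<star> g))) = E (E (E f)) \<star> g + f \<star> E (E (E g))" for f g
  proof -
    let ?p = "E (E f) \<star> E g" and ?q = "E f \<star> E (E g)"
    have "E (E (E (f \<star> g))) =
        E (E (E f)) \<star> g + f \<star> E (E (E g)) + (?p + (?p + ?p)) + (?q + (?q + ?q))"
      by (simp only: add mult add_ac)
    then show ?thesis
      by (simp only: char_3_triple_eq_0[OF assms(1)] add_0_right)
  qed
  then show ?thesis
    by (simp add: derivation_def eval_nat_numeral add)
qed

lemma derivation_shift_funpow: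
  assumes "CHAR('a::field) = 3"
  shows "derivation ((\<partial> :: (nat \<Rightarrow> 'a) \<Rightarrow> _) ^^ 3 ^ n)"
proof (induction n)
  case 0
  show ?case by (simp add: derivation_def shift_add shift_hurwitz_mult)
next
  case (Suc n)
  then show ?case
    using derivation_funpow_3[OF assms Suc] by (simp add: funpow_mult mult.commute)
qed

lemma shift_funpow_apply: "(\<partial> ^^ m) f k = f (k + m)"
  by (induction m arbitrary: k) (simp_all add: shift_def)

lemma dp_space_eq_kernel: "f \<in> dp_space n \<longleftrightarrow> (\<partial> ^^ 3 ^ n) f = 0"
proof -
  have "(\<forall>i\<ge>3 ^ n. f i = 0) \<longleftrightarrow> (\<forall>k. f (k + 3 ^ n) = 0)"
    by (metis le_add2 le_add_diff_inverse2)
  then show ?thesis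
    by (simp add: dp_space_def fun_eq_iff shift_funpow_apply)
qed

text \<open>The kernel of a derivation is a subalgebra.\<close>

lemma hurwitz_mult_in_dp_space:
  fixes f g :: "nat \<Rightarrow> 'a::field"
  assumes "CHAR('a) = 3" and "f \<in> dp_space n" and "g \<in> dp_space n"
  shows "f \<star> g \<in> dp_space n"
proof -
  have "(\<partial> ^^ 3 ^ n) (f \<star> g) = 0 \<star> g + f \<star> 0"
    using assms derivation_shift_funpow[OF assms(1), of n]
    by (simp add: derivation_def dp_space_eq_kernel)
  also have "\<dots> = 0"
    by (simp add: hurwitz_mult_def fun_eq_iff)
  finally show ?thesis
    by (simp add: dp_space_eq_kernel)
qed

lemma shift_in_dp_space: "f \<in> dp_space n \<Longrightarrow> \<partial> f \<in> dp_space n"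
  by (simp add: dp_space_def shift_def)

lemma diff_in_dp_space: "f \<in> dp_space n \<Longrightarrow> g \<in> dp_space n \<Longrightarrow> f - g \<in> dp_space n"
  by (simp add: dp_space_def)

lemma dp_deriv_eq_shift:
  assumes "f \<in> dp_space n"
  shows "dp_deriv n f = \<partial> f"
  using assms by (auto simp: fun_eq_iff dp_deriv_apply shift_def dp_space_def)

text \<open>
  Below degree \<open>3 ^ n\<close> both products have the same coefficients by definition.  From there on
  \<open>dp_mult\<close> is cut off, whereas for \<open>\<star>\<close> the coefficients vanish by closure.
\<close>

lemma dp_mult_eq_hurwitz_mult:
  fixes f g :: "nat \<Rightarrow> 'a::field"
  assumes "CHAR('a) = 3" and "f \<in> dp_space n" and "g \<in> dp_space n"
  shows "dp_mult n f g = f \<star> g"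
proof
  fix k
  have expand: "dp_mult n f g k =
      (\<Sum>i<3 ^ n. \<Sum>j<3 ^ n. f i * g j * of_nat ((i + j) choose i) * dp_basis n (i + j) k)"
    by (simp add: dp_mult_def sum_fun_apply fun_scale_def)
  show "dp_mult n f g k = (f \<star> g) k"
  proof (cases "k < 3 ^ n")
    case True
    have inner: "(\<Sum>j<3 ^ n. f i * g j * of_nat ((i + j) choose i) * dp_basis n (i + j) k) =
        (if i \<le> k then of_nat (k choose i) * f i * g (k - i) else 0)" for i
    proof -
      have "(\<Sum>j<3 ^ n. f i * g j * of_nat ((i + j) choose i) * dp_basis n (i + j) k) =
          (\<Sum>j<3 ^ n. if j = k - i then
             (if i \<le> k then of_nat (k choose i) * f i * g (k - i) else 0) else 0)"
        using True by (intro sum.cong) (auto simp: dp_basis_def)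
      also have "\<dots> = (if i \<le> k then of_nat (k choose i) * f i * g (k - i) else 0)"
        using True by (simp add: less_imp_diff_less)
      finally show ?thesis .
    qed
    have "dp_mult n f g k = (\<Sum>i\<in>{..<3 ^ n} \<inter> {i. i \<le> k}. of_nat (k choose i) * f i * g (k - i))"
      by (simp add: expand inner sum.If_cases)
    also have "{..<3 ^ n} \<inter> {i. i \<le> k} = {..k}"
      using True by auto
    finally show ?thesis
      by (simp add: hurwitz_mult_def)
  next
    case False
    then have "dp_mult n f g k = 0"
      unfolding expand by (intro sum.neutral ballI) (auto simp: dp_basis_def)
    moreover have "(f \<star> g) k = 0"
      using hurwitz_mult_in_dp_space[OF assms] False by (simp add: dp_space_def)
    ultimately show ?thesis by simp
  qed
qed

lemma subspace_dp_space: "module.subspace fun_scale (dp_space n :: (nat \<Rightarrow> 'a::field) set)"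
proof -
  interpret vector_space "fun_scale :: 'a \<Rightarrow> (nat \<Rightarrow> 'a) \<Rightarrow> nat \<Rightarrow> 'a"
    by (rule vector_space_fun_scale)
  show ?thesis
    by (simp add: subspace_def dp_space_def fun_scale_def)
qed


section \<open>The triple product\<close>

definition wronskian :: "(nat \<Rightarrow> 'a::field) \<Rightarrow> (nat \<Rightarrow> 'a) \<Rightarrow> nat \<Rightarrow> 'a" where
  "wronskian f h = f \<star> \<partial> h - h \<star> \<partial> f"

lemma wronskian_in_dp_space:
  assumes "CHAR('a::field) = 3" and "(f :: nat \<Rightarrow> 'a) \<in> dp_space n" and "h \<in> dp_space n"
  shows "wronskian f h \<in> dp_space n"
  unfolding wronskian_def
  by (intro diff_in_dp_space hurwitz_mult_in_dp_space shift_in_dp_space assms)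

lemma dp_triple_eq_wronskian:
  fixes f g h :: "nat \<Rightarrow> 'a::field"
  assumes "CHAR('a) = 3" and "f \<in> dp_space n" and "g \<in> dp_space n" and "h \<in> dp_space n"
  shows "dp_triple n f g h = g \<star> wronskian f h"
proof -
  have "dp_triple n f g h = f \<star> g \<star> \<partial> h - h \<star> g \<star> \<partial> f"
    by (simp add: dp_triple_def assms dp_deriv_eq_shift dp_mult_eq_hurwitz_mult
        hurwitz_mult_in_dp_space shift_in_dp_space)
  also have "\<dots> = g \<star> wronskian f h"
    by (simp add: wronskian_def hurwitz_mult_simps)
  finally show ?thesis .
qed

text \<open>
  As a function of \<open>w\<close>, \<open>v \<star> W u w\<close> is the first-order operator \<open>u \<star> v \<star> \<partial> - v \<star> \<partial> u\<close>.  The left-hand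
  side is the commutator of two such operators, so its terms in \<open>\<partial> (\<partial> w)\<close> cancel, and the
  coefficients of \<open>\<partial> w\<close> and of \<open>w\<close> agree with those on the right by the Leibniz rule alone.
\<close>

lemma wronskian_triple_identity:
  "y \<star> wronskian x (v \<star> wronskian u w) - v \<star> wronskian u (y \<star> wronskian x w) =
   v \<star> wronskian (y \<star> wronskian x u) w + (x \<star> wronskian y v) \<star> wronskian u w"
  by (simp add: wronskian_def shift_diff shift_hurwitz_mult hurwitz_mult_simps algebra_simps)

text \<open>
  Both sides are multiples of the same product: \<open>W x z = - W z x\<close> makes the left-hand side
  \<open>2 (y \<star> W x z)\<close>, while the right-hand side is \<open>- (y \<star> W x z)\<close>.
\<close>

lemma wronskian_triple_skew:
  fixes x y z :: "nat \<Rightarrow> 'a::field"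
  assumes "CHAR('a) = 3"
  shows "y \<star> wronskian x z - y \<star> wronskian z x = x \<star> wronskian z y - z \<star> wronskian x y"
proof -
  let ?p = "y \<star> wronskian x z"
  have "(y \<star> wronskian x z - y \<star> wronskian z x) - (x \<star> wronskian z y - z \<star> wronskian x y) =
      ?p + (?p + ?p)"
    by (simp add: wronskian_def hurwitz_mult_simps algebra_simps)
  then show ?thesis
    by (simp only: char_3_triple_eq_0[OF assms] right_minus_eq)
qed

lemma J_ternary_algebra_dp_triple:
  assumes "CHAR('a::field) = 3"
  shows "J_ternary_algebra (fun_scale :: 'a \<Rightarrow> (nat \<Rightarrow> 'a) \<Rightarrow> nat \<Rightarrow> 'a) (dp_space n) (dp_triple n)"
proof -
  interpret vector_space "fun_scale :: 'a \<Rightarrow> (nat \<Rightarrow> 'a) \<Rightarrow> nat \<Rightarrow> 'a"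
    by (rule vector_space_fun_scale)
  note [simp] = dp_triple_eq_wronskian[OF assms] hurwitz_mult_in_dp_space[OF assms]
    wronskian_in_dp_space[OF assms] subspace_add[OF subspace_dp_space]
    subspace_scale[OF subspace_dp_space]
  show ?thesis
  proof
    show "dp_triple n x y z \<in> dp_space n"
      if "x \<in> dp_space n" "y \<in> dp_space n" "z \<in> dp_space n" for x y z :: "nat \<Rightarrow> 'a"
      using that by simp
  next
    fix x y u v w :: "nat \<Rightarrow> 'a"
    assume "x \<in> dp_space n" "y \<in> dp_space n" "u \<in> dp_space n" "v \<in> dp_space n" "w \<in> dp_space n"
    then show "dp_triple n x y (dp_triple n u v w) - dp_triple n u v (dp_triple n x y w) =
        dp_triple n (dp_triple n x y u) v w + dp_triple n u (dp_triple n y x v) w"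
      by (simp add: wronskian_triple_identity)
  next
    fix x y z :: "nat \<Rightarrow> 'a"
    assume "x \<in> dp_space n" "y \<in> dp_space n" "z \<in> dp_space n"
    then show "dp_triple n x y z - dp_triple n z y x = dp_triple n z x y - dp_triple n x z y"
      by (simp add: wronskian_triple_skew[OF assms])
  qed (simp_all add: subspace_dp_space wronskian_def shift_add shift_fun_scale hurwitz_mult_add_left
      hurwitz_mult_add_right hurwitz_mult_diff_right hurwitz_mult_fun_scale_left
      hurwitz_mult_fun_scale_right fun_scale_diff)
qed


section \<open>Simplicity\<close>

definition hurwitz_const :: "'a::field \<Rightarrow> nat \<Rightarrow> 'a" where
  "hurwitz_const c = (\<lambda>i. if i = 0 then c else 0)"

lemma hurwitz_mult_const_left: "hurwitz_const c \<star> f = fun_scale c f"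
proof
  fix k
  have "(hurwitz_const c \<star> f) k = (\<Sum>i\<le>k. if i = 0 then c * f k else 0)"
    unfolding hurwitz_mult_def by (rule sum.cong) (auto simp: hurwitz_const_def)
  then show "(hurwitz_const c \<star> f) k = fun_scale c f k"
    by (simp add: fun_scale_def)
qed

lemma wronskian_one_left: "wronskian (hurwitz_const 1) f = \<partial> f"
proof -
  have "\<partial> (hurwitz_const 1 :: nat \<Rightarrow> 'a) = 0"
    by (simp add: shift_def hurwitz_const_def fun_eq_iff)
  then show ?thesis
    by (simp add: wronskian_def hurwitz_mult_const_left)
       (simp add: hurwitz_mult_def fun_scale_def fun_eq_iff)
qed

text \<open>
  If \<open>d\<close> is the last index with \<open>f d \<noteq> 0\<close>, then differentiating \<open>d\<close> times leaves a nonzero constant.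
\<close>

lemma shift_funpow_eq_const:
  assumes "f \<in> dp_space n" and "f \<noteq> 0"
  obtains d c where "c \<noteq> 0" and "(\<partial> ^^ d) f = hurwitz_const c"
proof -
  let ?S = "{i. f i \<noteq> 0}"
  have "?S \<subseteq> {..<3 ^ n}"
    using assms(1) by (auto simp: dp_space_def simp flip: not_le)
  then have fin: "finite ?S"
    by (rule finite_subset) simp
  have "?S \<noteq> {}"
    using assms(2) by (auto simp: fun_eq_iff)
  with fin have "Max ?S \<in> ?S"
    by (rule Max_in)
  then have nz: "f (Max ?S) \<noteq> 0"
    by simp
  have "f (k + Max ?S) = 0" if "k \<noteq> 0" for k
    using Max_ge[OF fin, of "k + Max ?S"] that by fastforce
  then have "(\<partial> ^^ Max ?S) f = hurwitz_const (f (Max ?S))"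
    by (auto simp: fun_eq_iff shift_funpow_apply hurwitz_const_def)
  with nz show thesis
    by (rule that)
qed

theorem lemma3p5:
  fixes n :: nat
  assumes "CHAR('a::field) = 3" and "n \<ge> 1"
  shows "simple_J_ternary_algebra (fun_scale :: 'a \<Rightarrow> (nat \<Rightarrow> 'a) \<Rightarrow> (nat \<Rightarrow> 'a))
    (dp_space n) (dp_triple n)"
proof -
  interpret J_ternary_algebra "fun_scale :: 'a \<Rightarrow> (nat \<Rightarrow> 'a) \<Rightarrow> nat \<Rightarrow> 'a" "dp_space n" "dp_triple n"
    by (rule J_ternary_algebra_dp_triple[OF assms(1)])
  let ?one = "hurwitz_const 1 :: nat \<Rightarrow> 'a"
  define x :: "nat \<Rightarrow> 'a" where "x = (\<lambda>i. if i = 1 then 1 else 0)"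
  have one: "?one \<in> dp_space n"
    by (simp add: dp_space_def hurwitz_const_def)
  \<comment> \<open>This is where \<open>n \<ge> 1\<close> enters: for \<open>n = 0\<close> the algebra consists of the constants.\<close>
  have x: "x \<in> dp_space n"
    using one_less_power[of "3 :: nat" n] assms(2) by (auto simp: dp_space_def x_def)
  have "\<partial> x = ?one"
    by (simp add: x_def shift_def hurwitz_const_def)
  then have triple_one_x: "dp_triple n ?one g x = g" if "g \<in> dp_space n" for g
    using that one x hurwitz_mult_const_left[of 1 g]
    by (simp add: dp_triple_eq_wronskian assms(1) wronskian_one_left hurwitz_mult_commute[of g])
  have triple_one_one: "dp_triple n ?one ?one f = \<partial> f" if "f \<in> dp_space n" for f
    using that one by (simp add: dp_triple_eq_wronskian assms(1) wronskian_one_left hurwitz_mult_const_left)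
  show ?thesis
  proof
    have "?one \<noteq> 0"
      by (auto simp: hurwitz_const_def fun_eq_iff)
    then show "\<exists>x\<in>dp_space n. \<exists>y\<in>dp_space n. \<exists>z\<in>dp_space n. dp_triple n x y z \<noteq> (0 :: nat \<Rightarrow> 'a)"
      using triple_one_x[OF one] one x by metis
  next
    fix I :: "(nat \<Rightarrow> 'a) set"
    assume I: "ideal I"
    then have sub: "I \<subseteq> dp_space n" and sp: "subspace I"
      by (auto simp: ideal_def)
    show "I = {0} \<or> I = dp_space n"
    proof (cases "I \<subseteq> {0}")
      case True
      then show ?thesis
        using subspace_0[OF sp] by auto
    next
      case False
      then obtain f where f: "f \<in> I" "f \<noteq> 0"
        by auto
      have shift_I: "\<partial> h \<in> I" if "h \<in> I" for h
        using I that one sub triple_one_one[of h] by (metis ideal_def subsetD)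
      have funpow_I: "(\<partial> ^^ m) f \<in> I" for m
        by (induction m) (simp_all add: f shift_I)
      obtain d c where c: "c \<noteq> 0" "(\<partial> ^^ d) f = hurwitz_const c"
        using shift_funpow_eq_const f sub by blast
      have "fun_scale (inverse c) (hurwitz_const c) \<in> I"
        using funpow_I[of d] c by (simp add: subspace_scale[OF sp])
      also have "fun_scale (inverse c) (hurwitz_const c) = ?one"
        using c by (auto simp: fun_scale_def hurwitz_const_def fun_eq_iff)
      finally have "?one \<in> I" .
      then have "g \<in> I" if "g \<in> dp_space n" for g
        using I that one x triple_one_x[OF that] by (metis ideal_def)
      then show ?thesis
        using sub by auto
    qed
  qed
qed

end
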